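(* Assume the following. (1) There exists an integer $Q\ge1$ such that, for all integers $t\ge0$, the union graph $\bigcup_{\tau=tQ}^{(t+1)Q-1}G_{\mathrm{cmm}}(\tau)$ of the communication graphs is strongly connected. (2) $\Theta$ and $\Gamma$ are subsets of finite-dimensional real vector spaces, and the product set $\mathcal S_\Theta\times\mathcal S_\Gamma$ is compact and convex. (3) $\boldsymbol g$ is differentiable, and $\nabla\boldsymbol g$ is bounded and Lipschitz continuous, with constant $L>0$, over $\mathcal S_\Theta\times\mathcal S_\Gamma$. (4) $0<\alpha<\frac{2}{L}$. Then, for every agent $i\in\{1,\dots,N\}$, any limit point of the sequence $\{(\hat{\boldsymbol\theta}_i(t),\hat{\boldsymbol\gamma}_i(t))\}_{t\in\mathbb N}$ generated by the distributed algorithm described in the context with step-size $\alpha$ is a stationary point of the objective function $\boldsymbol\phi^\top\boldsymbol g$ over the feasible set $\mathcal S_\Theta\times\mathcal S_\Gamma$.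
   Context: Score graph: $G_S=(\{1,\dots,N\},E_S)$ is a digraph, with $n=|E_S|$ edges, in which every node has at least one incoming edge; each edge $(i,j)\in E_S$ carries an observed score $y_{ij}$ in a finite set $\{r_1,\dots,r_R\}$ of $R$ elements. $N_i^I=\{j:(j,i)\in E_S\}$, $n_i=|N_i^I|$, $n_i^{(h)}=|\{j\in N_i^I:y_{ji}=r_h\}|$. Functions: for $h\in\{1,\dots,R\}$ and $\ell,m\in\{1,\dots,C\}$ there are given continuous functions $p_{h|\ell,m}$ on a set $\Theta$ (conditional probability of score $r_h$ given that the evaluating agent has state number $\ell$ and the evaluated agent state number $m$) and $p_\ell$ on a set $\Gamma$ (prior probability of state number $\ell$). $\mathcal S_\Theta=\{\boldsymbol\theta\in\Theta: p_{h|\ell,m}(\boldsymbol\theta)\in[0,1],\ \sum_{h=1}^R p_{h|\ell,m}(\boldsymbol\theta)=1\ \text{for all } h,\ell,m\}$, $\mathcal S_\Gamma=\{\boldsymbol\gamma\in\Gamma: p_\ell(\boldsymbol\gamma)\in[0,1]\ \text{for all }\ell,\ \sum_{\ell=1}^C p_\ell(\boldsymbol\gamma)=1\}$. Set $\boldsymbol g=(g_{(1)},\dots,g_{(R)})$ and $\boldsymbol\phi=(\phi^{(1)},\dots,\phi^{(R)})$ with $$g_{(h)}(\boldsymbol\theta,\boldsymbol\gamma)=-\log\Big(\sum_{\ell,m=1}^C p_{h|\ell,m}(\boldsymbol\theta)p_\ell(\boldsymbol\gamma)p_m(\boldsymbol\gamma)\Big),\qquad \phi^{(h)}=\sum_{i=1}^N\frac{n_i^{(h)}}{n}.$$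 $\nabla\boldsymbol g$ is the Jacobian of $\boldsymbol g$, so that $\boldsymbol\psi^\top\nabla\boldsymbol g$ denotes the gradient of $\boldsymbol\psi^\top\boldsymbol g$ for a fixed vector $\boldsymbol\psi\in\mathbb R^R$. Norms are Euclidean (with the induced operator norm for Jacobians). Differentiability of $\boldsymbol g$ means that $\boldsymbol g$ is finite and differentiable at every point of $\mathcal S_\Theta\times\mathcal S_\Gamma$. Communication graph: a time-dependent digraph $G_{\mathrm{cmm}}(t)=(\{1,\dots,N\},E_{\mathrm{cmm}}(t))$, $t\in\mathbb Z_{\ge0}$, with in- and out-neighborhoods $N_{\mathrm{cmm},i}^I(t)=\{j:(j,i)\in E_{\mathrm{cmm}}(t)\}\cup\{i\}$ and $N_{\mathrm{cmm},i}^O(t)=\{j:(i,j)\in E_{\mathrm{cmm}}(t)\}\cup\{i\}$, and $d_j(t)=|N_{\mathrm{cmm},j}^O(t)|$. Distributed algorithm: each agent $i$ initializes $\xi_i^{(h)}(0)=n_i^{(h)}$ for $h=1,\dots,R$, $\eta_i(0)=n_i$, $\phi_i^{(h)}(0)=\xi_i^{(h)}(0)/\eta_i(0)$, and $(\hat{\boldsymbol\theta}_i(0),\hat{\boldsymbol\gamma}_i(0))$ at an arbitrary point of $\mathcal S_\Theta\times\mathcal S_\Gamma$. For $t\ge0$, $$\xi_i^{(h)}(t+1)=\sum_{j\in N_{\mathrm{cmm},i}^I(t)}\frac{\xi_j^{(h)}(t)}{d_j(t)},\qquad \eta_i(t+1)=\sum_{j\in N_{\mathrm{cmm},i}^I(t)}\frac{\eta_j(t)}{d_j(t)},\qquad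 \phi_i^{(h)}(t+1)=\frac{\xi_i^{(h)}(t+1)}{\eta_i(t+1)},$$ and, with $\boldsymbol\phi_i(t)=(\phi_i^{(1)}(t),\dots,\phi_i^{(R)}(t))$, $$(\hat{\boldsymbol\theta}_i(t+1),\hat{\boldsymbol\gamma}_i(t+1))=\Big[(\hat{\boldsymbol\theta}_i(t),\hat{\boldsymbol\gamma}_i(t))-\alpha\,\boldsymbol\phi_i(t)^\top\nabla\boldsymbol g(\hat{\boldsymbol\theta}_i(t),\hat{\boldsymbol\gamma}_i(t))\Big]^+,$$ where $[\cdot]^+$ is the Euclidean projection onto $\mathcal S_\Theta\times\mathcal S_\Gamma$. A point $\hat z\in K$ is a stationary point of a differentiable function $f$ over a convex set $K$ if $\nabla f(\hat z)^\top(z-\hat z)\ge0$ for all $z\in K$. *)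

theory Defs
  imports "Graph_Theory.Digraph_Component" "HOL-Analysis.Analysis"
begin

text \<open>
  Conventions. Agents are the natural numbers \<open>1..N\<close>, state numbers the natural numbers \<open>1..C\<close>;
  score numbers are the elements of a finite type \<open>'r\<close>, so \<open>R = CARD('r)\<close> and vectors in
  \<open>\<real>\<^sup>R\<close> are of type \<open>real^'r\<close>. A digraph on \<open>{1..N}\<close> is given by its edge set.
  The norm on the product of two Euclidean spaces is the Euclidean one.
\<close>

subsection \<open>Score graph\<close>

definition in_nbrs :: "(nat \<times> nat) set \<Rightarrow> nat \<Rightarrow> nat set" where
  "in_nbrs E i = {j. (j, i) \<in> E}"

definition in_count :: "(nat \<times> nat) set \<Rightarrow> nat \<Rightarrow> nat" where
  "in_count E i = card (in_nbrs E i)"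

definition score_count ::
  "(nat \<times> nat) set \<Rightarrow> (nat \<Rightarrow> nat \<Rightarrow> 's) \<Rightarrow> ('r \<Rightarrow> 's) \<Rightarrow> 'r \<Rightarrow> nat \<Rightarrow> nat" where
  "score_count E y r h i = card {j \<in> in_nbrs E i. y j i = r h}"

definition score_freq ::
  "nat \<Rightarrow> (nat \<times> nat) set \<Rightarrow> (nat \<Rightarrow> nat \<Rightarrow> 's) \<Rightarrow> ('r::finite \<Rightarrow> 's) \<Rightarrow> real^'r" where
  "score_freq N E y r = (\<chi> h. \<Sum>i=1..N. real (score_count E y r h i) / real (card E))"

subsection \<open>Probability model and cost\<close>

text \<open>\<open>p h l m\<close> stands for \<open>p\<^bsub>h|l,m\<^esub>\<close> and \<open>q l\<close> for the prior \<open>p\<^bsub>l\<^esub>\<close>.\<close>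

definition feasible_theta ::
  "nat \<Rightarrow> 'a set \<Rightarrow> ('r::finite \<Rightarrow> nat \<Rightarrow> nat \<Rightarrow> 'a \<Rightarrow> real) \<Rightarrow> 'a set" where
  "feasible_theta C \<Theta> p =
     {\<theta> \<in> \<Theta>. \<forall>l\<in>{1..C}. \<forall>m\<in>{1..C}. (\<forall>h. p h l m \<theta> \<in> {0..1}) \<and> (\<Sum>h\<in>UNIV. p h l m \<theta>) = 1}"

definition feasible_gamma :: "nat \<Rightarrow> 'b set \<Rightarrow> (nat \<Rightarrow> 'b \<Rightarrow> real) \<Rightarrow> 'b set" where
  "feasible_gamma C \<Gamma> q = {\<gamma> \<in> \<Gamma>. (\<forall>l\<in>{1..C}. q l \<gamma> \<in> {0..1}) \<and> (\<Sum>l=1..C. q l \<gamma>) = 1}"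

definition score_prob ::
  "nat \<Rightarrow> ('r \<Rightarrow> nat \<Rightarrow> nat \<Rightarrow> 'a \<Rightarrow> real) \<Rightarrow> (nat \<Rightarrow> 'b \<Rightarrow> real) \<Rightarrow> 'r \<Rightarrow> 'a \<times> 'b \<Rightarrow> real" where
  "score_prob C p q h x =
     (\<Sum>l=1..C. \<Sum>m=1..C. p h l m (fst x) * q l (snd x) * q m (snd x))"

text \<open>This is the mathematical \<open>g\<close> only where every \<open>score_prob\<close> is positive, since \<open>ln\<close> is a
  total function here; finiteness of \<open>g\<close> therefore has to be assumed separately.\<close>

definition neg_log_prob ::
  "nat \<Rightarrow> ('r::finite \<Rightarrow> nat \<Rightarrow> nat \<Rightarrow> 'a \<Rightarrow> real) \<Rightarrow> (nat \<Rightarrow> 'b \<Rightarrow> real) \<Rightarrow> 'a \<times> 'b \<Rightarrow> real^'r" where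
  "neg_log_prob C p q x = (\<chi> h. - ln (score_prob C p q h x))"

subsection \<open>Push-sum consensus over the communication graph\<close>

definition cmm_in :: "(nat \<times> nat) set \<Rightarrow> nat \<Rightarrow> nat set" where
  "cmm_in E i = {j. (j, i) \<in> E} \<union> {i}"

definition cmm_out :: "(nat \<times> nat) set \<Rightarrow> nat \<Rightarrow> nat set" where
  "cmm_out E i = {j. (i, j) \<in> E} \<union> {i}"

primrec push_sum ::
  "(nat \<Rightarrow> (nat \<times> nat) set) \<Rightarrow> (nat \<Rightarrow> real) \<Rightarrow> nat \<Rightarrow> nat \<Rightarrow> real" where
  "push_sum E x0 0 i = x0 i"
| "push_sum E x0 (Suc t) i =
     (\<Sum>j\<in>cmm_in (E t) i. push_sum E x0 t j / real (card (cmm_out (E t) j)))"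

definition local_freq ::
  "(nat \<times> nat) set \<Rightarrow> (nat \<Rightarrow> nat \<Rightarrow> 's) \<Rightarrow> ('r::finite \<Rightarrow> 's) \<Rightarrow> (nat \<Rightarrow> (nat \<times> nat) set)
     \<Rightarrow> nat \<Rightarrow> nat \<Rightarrow> real^'r" where
  "local_freq ES y r Ecmm t i =
     (\<chi> h. push_sum Ecmm (\<lambda>j. real (score_count ES y r h j)) t i
          / push_sum Ecmm (\<lambda>j. real (in_count ES j)) t i)"

subsection \<open>Projected gradient step and stationarity\<close>

text \<open>If \<open>J\<close> is the Jacobian of \<open>g\<close> at \<open>x\<close>, then \<open>adjoint J \<psi>\<close> is the vector \<open>\<psi>\<^sup>T \<nabla>g\<close>,
  i.e. the gradient of \<open>\<psi>\<^sup>T g\<close> at \<open>x\<close>.\<close>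

definition proj_grad_step ::
  "'z::euclidean_space set \<Rightarrow> real \<Rightarrow> ('z \<Rightarrow> 'z \<Rightarrow>\<^sub>L (real^'r::finite)) \<Rightarrow> real^'r \<Rightarrow> 'z \<Rightarrow> 'z" where
  "proj_grad_step K \<alpha> J \<psi> x =
     closest_point K (x - \<alpha> *\<^sub>R adjoint (blinfun_apply (J x)) \<psi>)"

text \<open>\<open>D\<close> is the domain of \<open>f\<close>. Gradients are taken relative to \<open>D\<close>, which is the ordinary
  notion at interior points of \<open>D\<close>. If \<open>D\<close> is too thin at \<open>x\<close> for the gradient to be unique,
  the inequality is required of every gradient.\<close>

definition stationary_point ::
  "'z::euclidean_space set \<Rightarrow> ('z \<Rightarrow> real) \<Rightarrow> 'z set \<Rightarrow> 'z \<Rightarrow> bool" where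
  "stationary_point D f K x \<longleftrightarrow>
     x \<in> K \<and> f differentiable (at x within D) \<and>
     (\<forall>v. (f has_derivative (\<lambda>d. v \<bullet> d)) (at x within D) \<longrightarrow> (\<forall>z\<in>K. v \<bullet> (z - x) \<ge> 0))"

end

(* Over card V * Q steps, push-sum carries at least a fixed fraction of the total of any nonnegative
   initial masses to each node. Applied to M * eta + (xi - phi * eta) and M * eta - (xi - phi * eta),
   this shows that the local frequencies xi / eta converge to phi geometrically, hence summably.
   Since norm phi <= 1, the gradient of phi . g is L-Lipschitz, so each projected step decreases the
   objective by a multiple of the squared displacement, up to a summable error. The displacements
   therefore tend to 0, and the variational inequality of the projection passes to the limit. *)

theory Submission
  imports Defs
begin

section \<open>Linearity and restarting of push-sum; edges leaving a cut\<close>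

lemma push_sum_diff:
  "push_sum E (\<lambda>j. a * u j - b * v j) t i = a * push_sum E u t i - b * push_sum E v t i"
  by (induction t arbitrary: i)
    (simp_all add: sum_subtractf sum_distrib_left diff_divide_distrib)

text \<open>Push-sum remembers only its current masses, so it can be restarted at any time on the
  shifted graph sequence. This lets an estimate for one block of steps be iterated.\<close>

lemma push_sum_add:
  "push_sum E u (s + t) i = push_sum (\<lambda>\<tau>. E (s + \<tau>)) (push_sum E u s) t i"
  by (induction t arbitrary: i) simp_all

text \<open>A path from a node of \<open>X\<close> to a node outside has to cross an edge leaving
  \<open>X\<close>; otherwise induction along the path would keep it in \<open>X\<close>.\<close>

lemma strongly_connected_cut:
  assumes "strongly_connected (with_proj \<lparr>pverts = V, parcs = A\<rparr>)"
    and "X \<subseteq> V" "X \<noteq> {}" "X \<noteq> V"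
  obtains i j where "(i, j) \<in> A" "i \<in> X" "j \<in> V - X"
proof -
  let ?G = "with_proj \<lparr>pverts = V, parcs = A\<rparr>"
  obtain u v where uv: "u \<in> X" "v \<in> V" "v \<notin> X"
    using assms(2-4) by blast
  have reach: "u \<rightarrow>\<^sup>*\<^bsub>?G\<^esub> v"
    using assms(1,2) uv by (auto simp: strongly_connected_def)
  have "\<exists>i j. (i, j) \<in> A \<and> i \<in> X \<and> j \<in> V - X"
  proof (rule ccontr)
    assume no_edge: "\<nexists>i j. (i, j) \<in> A \<and> i \<in> X \<and> j \<in> V - X"
    have "(u, v) \<in> rtrancl_on V A"
      using reach by (simp add: reachable_def arcs_ends_def arc_to_ends_def)
    then have "v \<in> X"
    proof (induction v rule: rtrancl_on_induct)
      case base
      show ?case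
        by (rule uv(1))
    next
      case (step y z)
      then show ?case
        using no_edge by blast
    qed
    then show False
      using uv by blast
  qed
  then show thesis
    using that by blast
qed

section \<open>Positivity and conservation of mass\<close>

locale comm_network =
  fixes V :: "nat set" and E :: "nat \<Rightarrow> (nat \<times> nat) set"
  assumes finite_V: "finite V" and V_nonempty: "V \<noteq> {}" and edges: "E t \<subseteq> V \<times> V"
begin

lemma cmm_in_subset: "i \<in> V \<Longrightarrow> cmm_in (E t) i \<subseteq> V"
  using edges by (auto simp: cmm_in_def)

lemma cmm_out_subset: "i \<in> V \<Longrightarrow> cmm_out (E t) i \<subseteq> V"
  using edges by (auto simp: cmm_out_def)

lemma finite_cmm: "i \<in> V \<Longrightarrow> finite (cmm_in (E t) i)" "i \<in> V \<Longrightarrow> finite (cmm_out (E t) i)"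
  using cmm_in_subset cmm_out_subset finite_V finite_subset by metis+

lemma card_cmm_out:
  assumes "i \<in> V"
  shows "0 < card (cmm_out (E t) i)" "card (cmm_out (E t) i) \<le> card V"
proof -
  show "0 < card (cmm_out (E t) i)"
    using finite_cmm[OF assms] by (auto simp: card_gt_0_iff cmm_out_def)
  show "card (cmm_out (E t) i) \<le> card V"
    using cmm_out_subset[OF assms] finite_V by (simp add: card_mono)
qed

lemma card_V_ge_1: "real (card V) \<ge> 1"
  using finite_V V_nonempty by (simp add: Suc_leI card_gt_0_iff)

lemma push_sum_nonneg:
  assumes "\<And>j. j \<in> V \<Longrightarrow> 0 \<le> u j" and "i \<in> V"
  shows "0 \<le> push_sum E u t i"
  using assms(2)
proof (induction t arbitrary: i)
  case (Suc t)
  then show ?case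
    using cmm_in_subset by (auto intro!: sum_nonneg divide_nonneg_nonneg)
qed (simp add: assms)

text \<open>A node splits its mass into at most \<open>card V\<close> equal shares and sends one to
  each out-neighbor, itself included; all other contributions are nonnegative.\<close>

lemma push_sum_Suc_ge:
  assumes "\<And>j. j \<in> V \<Longrightarrow> 0 \<le> u j" and "i \<in> V" and "j \<in> cmm_in (E t) i"
  shows "push_sum E u t j / card V \<le> push_sum E u (Suc t) i"
proof -
  have j: "j \<in> V"
    using assms cmm_in_subset by blast
  have "push_sum E u t j / card V \<le> push_sum E u t j / card (cmm_out (E t) j)"
    using card_cmm_out[OF j] push_sum_nonneg[OF assms(1) j] card_V_ge_1
    by (intro divide_left_mono mult_pos_pos) auto
  also have "\<dots> \<le> push_sum E u (Suc t) i"
    unfolding push_sum.simps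
    using cmm_in_subset assms push_sum_nonneg[OF assms(1)] finite_cmm
    by (intro member_le_sum) (auto simp: subset_iff)
  finally show ?thesis .
qed

text \<open>The self-loop returns to \<open>i\<close> a share of its own mass. Hence the
  denominators of the push-sum ratios never vanish.\<close>

lemma push_sum_pos:
  assumes "\<And>j. j \<in> V \<Longrightarrow> 0 < u j" and "i \<in> V"
  shows "0 < push_sum E u t i"
proof (induction t)
  case (Suc t)
  have "0 < push_sum E u t i / card V"
    using Suc card_V_ge_1 by simp
  also have "\<dots> \<le> push_sum E u (Suc t) i"
    using assms by (intro push_sum_Suc_ge) (auto simp: cmm_in_def less_imp_le)
  finally show ?case .
qed (simp add: assms)

text \<open>Node \<open>j\<close> hands one of its \<open>card (cmm_out (E t) j)\<close> equal
  shares to each receiver, so exchanging the order of summation recovers its whole mass.\<close>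

lemma sum_push_sum: "(\<Sum>i\<in>V. push_sum E u t i) = (\<Sum>i\<in>V. u i)"
proof (induction t)
  case (Suc t)
  let ?a = "\<lambda>j. push_sum E u t j / card (cmm_out (E t) j)"
  have "(\<Sum>i\<in>V. push_sum E u (Suc t) i) = (\<Sum>i\<in>V. \<Sum>j\<in>{j \<in> V. j \<in> cmm_in (E t) i}. ?a j)"
    using cmm_in_subset by (auto intro!: sum.cong)
  also have "\<dots> = (\<Sum>j\<in>V. \<Sum>i\<in>{i \<in> V. j \<in> cmm_in (E t) i}. ?a j)"
    using finite_V by (intro sum.swap_restrict)
  also have "\<dots> = (\<Sum>j\<in>V. push_sum E u t j)"
  proof (rule sum.cong)
    fix j assume j: "j \<in> V"
    have "{i \<in> V. j \<in> cmm_in (E t) i} = cmm_out (E t) j"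
      using j cmm_out_subset[OF j] by (auto simp: cmm_in_def cmm_out_def)
    then show "(\<Sum>i\<in>{i \<in> V. j \<in> cmm_in (E t) i}. ?a j) = push_sum E u t j"
      using card_cmm_out[OF j, of t] by simp
  qed simp
  finally show ?case
    using Suc by simp
qed simp

end

section \<open>Geometric mixing under joint connectivity\<close>

text \<open>Joint connectivity over each window of \<open>Q\<close> steps is expressed through cuts:
  this is what the growth argument consumes, and it is easy to transfer to a shifted
  sequence.\<close>

locale connected_comm_network = comm_network +
  fixes Q :: nat
  assumes Q_pos: "1 \<le> Q"
    and cut: "\<And>k X. X \<subseteq> V \<Longrightarrow> X \<noteq> {} \<Longrightarrow> X \<noteq> V \<Longrightarrow>
      \<exists>\<tau>\<in>{k * Q..<(k + 1) * Q}. \<exists>i\<in>X. \<exists>j\<in>V - X. (i, j) \<in> E \<tau>"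
begin

text \<open>Windows start at multiples of \<open>Q\<close>, so a shift by \<open>k * Q\<close> steps
  maps windows to windows.\<close>

lemma shift: "connected_comm_network V (\<lambda>\<tau>. E (k * Q + \<tau>)) Q"
proof unfold_locales
  fix m X assume "X \<subseteq> V" "X \<noteq> {}" "X \<noteq> V"
  then obtain \<tau> i j where *: "(k + m) * Q \<le> \<tau>" "\<tau> < (k + m + 1) * Q"
      "i \<in> X" "j \<in> V - X" "(i, j) \<in> E \<tau>"
    using cut[of X "k + m"] by fastforce
  then have "\<tau> - k * Q \<in> {m * Q..<(m + 1) * Q}" "k * Q + (\<tau> - k * Q) = \<tau>"
    by (auto simp: algebra_simps)
  with * show "\<exists>\<tau>\<in>{m * Q..<(m + 1) * Q}. \<exists>i\<in>X. \<exists>j\<in>V - X. (i, j) \<in> E (k * Q + \<tau>)"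
    by metis
qed (use finite_V V_nonempty edges Q_pos in auto)

text \<open>The set of nodes holding a guaranteed share of the mass started at \<open>j\<close>
  never shrinks, because of the self-loops, and each window enlarges it across a cut until it is all
  of \<open>V\<close>.\<close>

lemma push_sum_reaches_all:
  assumes u: "\<And>j. j \<in> V \<Longrightarrow> 0 \<le> u j" and j: "j \<in> V" and i: "i \<in> V"
  shows "u j / card V ^ (card V * Q) \<le> push_sum E u (card V * Q) i"
proof -
  \<comment> \<open>The threshold loses a factor \<open>card V\<close> per step, which is the loss
    allowed by \<open>push_sum_Suc_ge\<close>.\<close>
  define X where "X t = {i \<in> V. u j / card V ^ t \<le> push_sum E u t i}" for t
  have grow: "i' \<in> X (Suc t)" if "l \<in> X t" "i' \<in> V" "l \<in> cmm_in (E t) i'" for l i' t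
  proof -
    have "u j / card V ^ Suc t = (u j / card V ^ t) / card V"
      by simp
    also have "\<dots> \<le> push_sum E u t l / card V"
      using that by (intro divide_right_mono) (auto simp: X_def)
    also have "\<dots> \<le> push_sum E u (Suc t) i'"
      using that u by (intro push_sum_Suc_ge) auto
    finally show ?thesis
      using that by (simp add: X_def)
  qed
  have "X t \<subseteq> X (Suc t)" for t
    using grow by (auto simp: X_def cmm_in_def)
  then have mono: "X s \<subseteq> X t" if "s \<le> t" for s t
    using lift_Suc_mono_le that by metis
  have X: "X t \<subseteq> V" "finite (X t)" for t
    using finite_V by (auto simp: X_def)
  \<comment> \<open>\<open>Suc k\<close> because \<open>X 0\<close> already contains
    \<open>j\<close>; the minimum covers the windows after \<open>X\<close> has filled
    \<open>V\<close>.\<close>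
  have "min (card V) (Suc k) \<le> card (X (k * Q))" for k
  proof (induction k)
    case 0
    have "j \<in> X 0"
      using j by (simp add: X_def)
    then show ?case
      using X(2)[of 0] card_gt_0_iff[of "X 0"] by auto
  next
    case (Suc k)
    show ?case
    proof (cases "X (k * Q) = V")
      case True
      then have "X (Suc k * Q) = V"
        using mono[of "k * Q" "Suc k * Q"] X by auto
      then show ?thesis
        by simp
    next
      case False
      moreover have "X (k * Q) \<noteq> {}"
        using mono[of 0 "k * Q"] j by (auto simp: X_def)
      ultimately obtain \<tau> l i' where *: "\<tau> \<in> {k * Q..<(k + 1) * Q}"
          "l \<in> X (k * Q)" "i' \<in> V - X (k * Q)" "(l, i') \<in> E \<tau>"
        using cut X by meson
      \<comment> \<open>The edge may occur anywhere in the window; by monotonicity its tail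
        \<open>l\<close> is still in \<open>X\<close> at time \<open>\<tau>\<close>.\<close>
      have "i' \<in> X (Suc \<tau>)"
        using * mono[of "k * Q" \<tau>] by (intro grow) (auto simp: cmm_in_def)
      then have "i' \<in> X (Suc k * Q)"
        using mono[of "Suc \<tau>" "Suc k * Q"] * by auto
      then have "X (k * Q) \<subset> X (Suc k * Q)"
        using mono[of "k * Q" "Suc k * Q"] * by auto
      then have "card (X (k * Q)) < card (X (Suc k * Q))"
        using X by (simp add: psubset_card_mono)
      then show ?thesis
        using Suc by linarith
    qed
  qed
  from this[of "card V"] have "card V \<le> card (X (card V * Q))"
    by simp
  then have "X (card V * Q) = V"
    using X finite_V by (simp add: card_seteq)
  then show ?thesis
    using i by (auto simp: X_def)
qed

text \<open>A Doeblin constant: the fraction of the total mass guaranteed at every node after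
  \<open>card V * Q\<close> steps. The additional factor \<open>card V\<close> comes from summing
  the bound for a single source over all sources.\<close>

definition mix :: real where
  "mix = 1 / card V ^ Suc (card V * Q)"

lemma mix_bounds: "0 < mix" "mix \<le> 1"
proof -
  have "1 \<le> real (card V) ^ Suc (card V * Q)"
    using card_V_ge_1 by (rule one_le_power)
  then show "0 < mix" "mix \<le> 1"
    unfolding mix_def of_nat_power
    by (simp_all only: divide_le_eq_1_pos zero_less_divide_1_iff less_le_trans[OF zero_less_one])
qed

lemma push_sum_minorized:
  assumes "\<And>j. j \<in> V \<Longrightarrow> 0 \<le> u j" and "i \<in> V"
  shows "mix * (\<Sum>j\<in>V. u j) \<le> push_sum E u (card V * Q) i"
proof -
  have "(\<Sum>j\<in>V. u j / card V ^ (card V * Q)) \<le> (\<Sum>j\<in>V. push_sum E u (card V * Q) i)"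
    using assms by (intro sum_mono push_sum_reaches_all)
  then have "(\<Sum>j\<in>V. u j) / card V ^ (card V * Q) \<le> card V * push_sum E u (card V * Q) i"
    by (simp add: sum_divide_distrib)
  then show ?thesis
    using card_V_ge_1 by (simp add: mix_def divide_simps ac_simps)
qed

text \<open>Both \<open>M v + w\<close> and \<open>M v - w\<close> are nonnegative with total mass \<open>M \<Sum>v\<close>, so mixing moves at
  least the fraction \<open>mix\<close> of that mass to every node.\<close>

lemma push_sum_contract:
  assumes v: "\<And>j. j \<in> V \<Longrightarrow> 0 \<le> v j"
    and w: "\<And>j. j \<in> V \<Longrightarrow> \<bar>w j\<bar> \<le> M * v j" and w0: "(\<Sum>j\<in>V. w j) = 0"
    and M: "0 \<le> M" and i: "i \<in> V"
  shows "\<bar>push_sum E w (card V * Q) i\<bar> \<le> (1 - mix) * M * push_sum E v (card V * Q) i"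
proof -
  let ?P = "\<lambda>u. push_sum E u (card V * Q) i"
  \<comment> \<open>Conservation allows the total mass in the lower bound to be replaced by the mass
    now at \<open>i\<close>. The result compares \<open>w\<close> with \<open>v\<close> at the same
    node and time, so it can be iterated.\<close>
  have "?P v \<le> (\<Sum>j\<in>V. push_sum E v (card V * Q) j)"
    using i v push_sum_nonneg finite_V by (intro member_le_sum) auto
  then have total: "?P v \<le> (\<Sum>j\<in>V. v j)"
    by (simp add: sum_push_sum)
  have bound: "mix * (M * ?P v) \<le> M * ?P v - b * ?P w" if "\<bar>b\<bar> = 1" for b
  proof -
    have "b * w j \<le> M * v j" if "j \<in> V" for j
      using w[OF that] \<open>\<bar>b\<bar> = 1\<close> abs_le_D1[of "b * w j"] by (simp add: abs_mult)
    then have "mix * (\<Sum>j\<in>V. M * v j - b * w j) \<le> ?P (\<lambda>j. M * v j - b * w j)"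
      using i by (intro push_sum_minorized) auto
    then have "mix * (M * (\<Sum>j\<in>V. v j)) \<le> M * ?P v - b * ?P w"
      using w0 by (simp add: push_sum_diff sum_subtractf flip: sum_distrib_left)
    moreover have "mix * (M * ?P v) \<le> mix * (M * (\<Sum>j\<in>V. v j))"
      using total M mix_bounds by (intro mult_left_mono) auto
    ultimately show ?thesis
      by linarith
  qed
  show ?thesis
    using bound[of 1] bound[of "-1"] by (simp add: algebra_simps)
qed

text \<open>Each block of \<open>card V * Q\<close> steps contracts by \<open>1 - mix\<close>, a
  factor that depends on \<open>V\<close> and \<open>Q\<close> only and is therefore the same for
  all blocks. The incomplete last block preserves the bound by positivity.\<close>

lemma push_sum_geometric:
  assumes v: "\<And>j. j \<in> V \<Longrightarrow> 0 \<le> v j"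
    and w: "\<And>j. j \<in> V \<Longrightarrow> \<bar>w j\<bar> \<le> M * v j" and w0: "(\<Sum>j\<in>V. w j) = 0"
    and M: "0 \<le> M" and i: "i \<in> V"
  shows "\<bar>push_sum E w t i\<bar> \<le> (1 - mix) ^ (t div (card V * Q)) * M * push_sum E v t i"
proof -
  define T where "T = card V * Q"
  have block: "\<bar>push_sum E w (k * T) j\<bar> \<le> (1 - mix) ^ k * M * push_sum E v (k * T) j"
    if "j \<in> V" for j k
    using that
  proof (induction k arbitrary: j)
    case (Suc k)
    \<comment> \<open>The block starts at \<open>k * T = (k * card V) * Q\<close>, a multiple of
      \<open>Q\<close>, so the windows stay aligned.\<close>
    interpret S: connected_comm_network V "\<lambda>\<tau>. E (k * T + \<tau>)" Q
      using shift[of "k * card V"] by (simp add: T_def mult.assoc)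
    have shifted: "push_sum E u (Suc k * T) j = push_sum (\<lambda>\<tau>. E (k * T + \<tau>)) (push_sum E u (k * T)) T j"
      for u
      using push_sum_add[of E u "k * T" T j] by (simp add: add.commute)
    have "\<bar>push_sum (\<lambda>\<tau>. E (k * T + \<tau>)) (push_sum E w (k * T)) T j\<bar>
        \<le> (1 - mix) * ((1 - mix) ^ k * M) * push_sum (\<lambda>\<tau>. E (k * T + \<tau>)) (push_sum E v (k * T)) T j"
    proof (rule S.push_sum_contract[folded T_def])
      show "0 \<le> push_sum E v (k * T) l" if "l \<in> V" for l
        using v that by (rule push_sum_nonneg)
      show "(\<Sum>l\<in>V. push_sum E w (k * T) l) = 0"
        unfolding sum_push_sum by (rule w0)
      show "0 \<le> (1 - mix) ^ k * M"
        using M mix_bounds by simp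
    qed (use Suc in auto)
    then show ?case
      unfolding shifted by (simp add: mult.assoc)
  qed (use w in simp)
  define s where "s = t div T * T"
  interpret S: comm_network V "\<lambda>\<tau>. E (s + \<tau>)"
    using finite_V V_nonempty edges by unfold_locales auto
  let ?c = "(1 - mix) ^ (t div T) * M"
  have shifted: "push_sum E u t i = push_sum (\<lambda>\<tau>. E (s + \<tau>)) (push_sum E u s) (t mod T) i" for u
    using push_sum_add[of E u s "t mod T" i] by (simp add: s_def)
  have "b * push_sum E w t i \<le> ?c * push_sum E v t i" if "\<bar>b\<bar> = 1" for b
  proof -
    have "0 \<le> push_sum (\<lambda>\<tau>. E (s + \<tau>))
        (\<lambda>j. ?c * push_sum E v s j - b * push_sum E w s j) (t mod T) i"
    proof (rule S.push_sum_nonneg[OF _ i])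
      fix j assume "j \<in> V"
      from block[OF this, of "t div T"]
      show "0 \<le> ?c * push_sum E v s j - b * push_sum E w s j"
        using that abs_le_D1[of "b * push_sum E w s j"] by (simp add: abs_mult s_def)
    qed
    then show ?thesis
      unfolding push_sum_diff shifted[symmetric] by simp
  qed
  from this[of 1] this[of "-1"] show ?thesis
    by (auto simp: T_def abs_le_iff)
qed

text \<open>Mass conservation identifies the limit as the ratio of the totals. Summability, not just
  convergence, is what the descent argument requires of the gradient error.\<close>

lemma push_sum_ratio_summable:
  assumes v: "\<And>j. j \<in> V \<Longrightarrow> 0 < v j" and i: "i \<in> V"
  shows "summable (\<lambda>t. \<bar>push_sum E u t i / push_sum E v t i - (\<Sum>j\<in>V. u j) / (\<Sum>j\<in>V. v j)\<bar>)"
proof -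
  define c where "c = (\<Sum>j\<in>V. u j) / (\<Sum>j\<in>V. v j)"
  \<comment> \<open>\<open>w\<close> has total mass zero, and its push-sum divided by that of
    \<open>v\<close> is the deviation from \<open>c\<close>. The factor 1 gives it the shape of
    \<open>push_sum_diff\<close>.\<close>
  define w where "w j = 1 * u j - c * v j" for j
  define M where "M = (\<Sum>j\<in>V. \<bar>w j\<bar> / v j)"
  define T where "T = card V * Q"
  have T: "0 < T"
    using finite_V V_nonempty Q_pos by (simp add: T_def card_gt_0_iff)
  have "0 < (\<Sum>j\<in>V. v j)"
    using v finite_V V_nonempty by (simp add: sum_pos)
  then have w0: "(\<Sum>j\<in>V. w j) = 0"
    by (simp add: w_def sum_subtractf sum_distrib_left[symmetric] del: times_divide_eq_left) (simp add: c_def)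
  have nonneg: "0 \<le> \<bar>w j\<bar> / v j" if "j \<in> V" for j
    using v that by (simp add: less_imp_le)
  have M: "0 \<le> M"
    using nonneg by (simp add: M_def sum_nonneg)
  have w: "\<bar>w j\<bar> \<le> M * v j" if "j \<in> V" for j
  proof -
    have "\<bar>w j\<bar> / v j \<le> M"
      unfolding M_def using that nonneg finite_V by (intro member_le_sum) auto
    then show ?thesis
      using v[OF that] by (simp add: field_simps)
  qed
  have rate: "\<bar>push_sum E u t i / push_sum E v t i - c\<bar> \<le> M * (1 - mix) ^ (t div T)" for t
  proof -
    have pos: "0 < push_sum E v t i"
      using push_sum_pos v i by blast
    have "push_sum E u t i / push_sum E v t i - c = push_sum E w t i / push_sum E v t i"
      unfolding w_def push_sum_diff using pos by (simp add: diff_divide_distrib)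
    also have "\<bar>\<dots>\<bar> \<le> M * (1 - mix) ^ (t div T)"
      using push_sum_geometric[OF less_imp_le[OF v] w w0 M i, of t] pos
      by (simp add: T_def field_simps)
    finally show ?thesis .
  qed
  have "summable (\<lambda>t. (1 - mix) ^ (t div T))"
  proof (rule bounded_imp_summable)
    show "0 \<le> (1 - mix) ^ (t div T)" for t
      using mix_bounds by simp
    show "(\<Sum>t\<le>n. (1 - mix) ^ (t div T)) \<le> T * (1 / mix)" for n
    proof -
      \<comment> \<open>The range is padded to \<open>Suc n\<close> full blocks of length
        \<open>T\<close>. The exponent is constant on each, which leaves \<open>T\<close> times a
        geometric sum of at most \<open>1 / mix\<close>.\<close>
      have "n < Suc n * T"
        using mult_le_mono2[of 1 T "Suc n"] T by simp
      then have "{..n} \<subseteq> {..<Suc n * T}"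
        by auto
      then have "(\<Sum>t\<le>n. (1 - mix) ^ (t div T)) \<le> (\<Sum>t<Suc n * T. (1 - mix) ^ (t div T))"
        using mix_bounds by (intro sum_mono2) auto
      also have "\<dots> = (\<Sum>m<Suc n. \<Sum>t=m * T..<m * T + T. (1 - mix) ^ (t div T))"
        by (rule sum.nat_group[symmetric])
      also have "\<dots> = (\<Sum>m<Suc n. \<Sum>t=m * T..<m * T + T. (1 - mix) ^ m)"
        by (intro sum.cong refl arg_cong[where f = "(^) (1 - mix)"] div_nat_eqI)
          (auto simp: algebra_simps)
      also have "\<dots> = T * (\<Sum>m<Suc n. (1 - mix) ^ m)"
        by (simp only: sum_constant card_atLeastLessThan sum_distrib_left) simp
      also have "\<dots> \<le> T * (1 / mix)"
        using mix_bounds sum_gp_strict[of "1 - mix" "Suc n"]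
        by (intro mult_left_mono) (simp_all add: divide_right_mono del: sum.lessThan_Suc)
      finally show ?thesis .
    qed
  qed
  then have "summable (\<lambda>t. M * (1 - mix) ^ (t div T))"
    by (rule summable_mult)
  then show ?thesis
    by (rule summable_comparison_test'[where N = 0]) (use rate in \<open>simp add: c_def\<close>)
qed

end

section \<open>Projected gradient descent with summable errors\<close>

text \<open>The standard quadratic upper bound, for a gradient taken only relative to a convex set.
  Restriction to the segment from \<open>u\<close> to \<open>v\<close> reduces it to one real
  variable.\<close>

lemma descent_lemma:
  fixes f :: "'z::real_inner \<Rightarrow> real"
  assumes "convex S"
    and f: "\<And>z. z \<in> S \<Longrightarrow> (f has_derivative (\<lambda>d. G z \<bullet> d)) (at z within S)"
    and lip: "\<And>u v. u \<in> S \<Longrightarrow> v \<in> S \<Longrightarrow> norm (G u - G v) \<le> L * norm (u - v)"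
    and u: "u \<in> S" and v: "v \<in> S"
  shows "f v \<le> f u + G u \<bullet> (v - u) + L / 2 * (norm (v - u))\<^sup>2"
proof -
  define d where "d = v - u"
  \<comment> \<open>The quadratic model is subtracted so that the claim becomes
    \<open>h 1 \<le> h 0\<close>; the Lipschitz bound makes the derivative of \<open>h\<close>
    nonpositive.\<close>
  define h where "h s = f (u + s *\<^sub>R d) - s * (G u \<bullet> d) - L / 2 * s\<^sup>2 * (norm d)\<^sup>2" for s
  have seg: "u + s *\<^sub>R d \<in> S" if "0 \<le> s" "s \<le> 1" for s
    using convexD_alt[OF \<open>convex S\<close> u v that] by (simp add: d_def algebra_simps)
  have f_seg: "((\<lambda>s. f (u + s *\<^sub>R d)) has_derivative (\<lambda>r. G (u + s *\<^sub>R d) \<bullet> (r *\<^sub>R d)))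
      (at s within {0..1})" if "0 \<le> s" "s \<le> 1" for s
  proof -
    have d: "((\<lambda>s. u + s *\<^sub>R d) has_derivative (\<lambda>r. r *\<^sub>R d)) (at s within {0..1})"
      by (auto intro!: derivative_eq_intros)
    have sub: "(\<lambda>s. u + s *\<^sub>R d) ` {0..1} \<subseteq> S"
      using seg by auto
    show ?thesis
      by (rule has_derivative_in_compose2[OF f sub _ d]) (use that in auto)
  qed
  have h_deriv: "(h has_real_derivative (G (u + s *\<^sub>R d) - G u) \<bullet> d - L * s * (norm d)\<^sup>2)
      (at s within {0..1})" if "0 \<le> s" "s \<le> 1" for s
  proof -
    have "((\<lambda>s. f (u + s *\<^sub>R d)) has_real_derivative G (u + s *\<^sub>R d) \<bullet> d) (at s within {0..1})"
      using f_seg[OF that] by (simp add: has_field_derivative_def mult_commute_abs)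
    then show ?thesis
      unfolding h_def by (auto intro!: derivative_eq_intros simp: inner_diff_left)
  qed
  have "h 1 \<le> h 0"
  proof (rule DERIV_nonpos_imp_decreasing_open[where f = h])
    show "continuous_on {0..1} h"
      using h_deriv by (intro DERIV_continuous_on) auto
    fix s :: real assume s: "0 < s" "s < 1"
    have "(G (u + s *\<^sub>R d) - G u) \<bullet> d \<le> norm (G (u + s *\<^sub>R d) - G u) * norm d"
      by (rule norm_cauchy_schwarz)
    also have "\<dots> \<le> (L * norm (s *\<^sub>R d)) * norm d"
      using lip[OF seg[of s] u] s by (intro mult_right_mono) auto
    also have "\<dots> = L * s * (norm d)\<^sup>2"
      using s by (simp add: power2_eq_square)
    finally show "\<exists>y. DERIV h s :> y \<and> y \<le> 0"
      using h_deriv[of s] s at_within_interior[of s "{0..1}"] by auto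
  qed simp
  then show ?thesis
    by (simp add: h_def d_def)
qed

text \<open>The obtuse-angle property of the projection, tested at the point \<open>x\<close> of
  \<open>S\<close> itself.\<close>

lemma projected_step_inner_le:
  fixes x :: "'z::euclidean_space"
  assumes "convex S" "closed S" "x \<in> S" "0 < \<alpha>"
  shows "d \<bullet> (closest_point S (x - \<alpha> *\<^sub>R d) - x)
    \<le> - (norm (closest_point S (x - \<alpha> *\<^sub>R d) - x))\<^sup>2 / \<alpha>"
proof -
  let ?x' = "closest_point S (x - \<alpha> *\<^sub>R d)"
  have "(x - \<alpha> *\<^sub>R d - ?x') \<bullet> (x - ?x') \<le> 0"
    using assms by (intro closest_point_dot)
  then have "(norm (?x' - x))\<^sup>2 + \<alpha> * (d \<bullet> (?x' - x)) \<le> 0"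
    by (simp add: power2_norm_eq_inner algebra_simps inner_commute)
  then show ?thesis
    using \<open>0 < \<alpha>\<close> by (simp add: field_simps)
qed

text \<open>Here \<open>d\<close> is an inexact gradient along the iterates. Since \<open>f\<close>
  is bounded below on \<open>S\<close>, summing the descent inequality makes the squared
  displacements summable, and consecutive iterates share their limit along
  \<open>\<sigma>\<close>.\<close>

lemma perturbed_projected_gradient_limit:
  fixes f :: "'z::euclidean_space \<Rightarrow> real"
  assumes S: "compact S" "convex S"
    and f: "\<And>z. z \<in> S \<Longrightarrow> (f has_derivative (\<lambda>d. G z \<bullet> d)) (at z within S)"
    and lip: "L-lipschitz_on S G" and L: "0 < L"
    and \<alpha>: "0 < \<alpha>" "\<alpha> < 2 / L"
    and x0: "x 0 \<in> S" and step: "\<And>t. x (Suc t) = closest_point S (x t - \<alpha> *\<^sub>R d t)"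
    and err: "summable (\<lambda>t. norm (d t - G (x t)))"
    and \<sigma>: "strict_mono \<sigma>" and lim: "(x \<circ> \<sigma>) \<longlonglongrightarrow> z"
  shows "z \<in> S" and "w \<in> S \<Longrightarrow> 0 \<le> G z \<bullet> (w - z)"
proof -
  have closed: "closed S"
    using S by (simp add: compact_imp_closed)
  have x: "x t \<in> S" for t
    using x0 closed by (cases t) (auto simp: step intro!: closest_point_in_set)
  show z: "z \<in> S"
    using closed_sequentially[OF closed _ lim] x by simp
  define \<Delta> where "\<Delta> t = x (Suc t) - x t" for t
  define e where "e t = norm (d t - G (x t))" for t
  \<comment> \<open>The projection gains \<open>1 / \<alpha>\<close> and the quadratic bound costs
    \<open>L / 2\<close>; \<open>\<alpha> < 2 / L\<close> makes the balance positive.\<close>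
  define c where "c = 1 / \<alpha> - L / 2"
  have c: "0 < c"
    using L \<alpha> by (simp add: c_def field_simps)
  obtain D where D: "norm y \<le> D" if "y \<in> S" for y
    using compact_imp_bounded[OF S(1)] by (auto simp: bounded_iff)
  have "continuous_on S f"
    using f by (meson continuous_on_eq_continuous_within has_derivative_continuous)
  then obtain m where m: "m \<le> f y" if "y \<in> S" for y
    using continuous_attains_inf[OF S(1)] x0 by blast
  have descent: "c * (norm (\<Delta> t))\<^sup>2 \<le> f (x t) - f (x (Suc t)) + 2 * D * e t" for t
  proof -
    have "f (x (Suc t)) \<le> f (x t) + G (x t) \<bullet> \<Delta> t + L / 2 * (norm (\<Delta> t))\<^sup>2"
      unfolding \<Delta>_def using lip x
      by (intro descent_lemma[OF S(2) f]) (auto simp: lipschitz_on_def dist_norm)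
    moreover have "G (x t) \<bullet> \<Delta> t = d t \<bullet> \<Delta> t + (G (x t) - d t) \<bullet> \<Delta> t"
      by (simp add: inner_diff_left)
    moreover have "d t \<bullet> \<Delta> t \<le> - (norm (\<Delta> t))\<^sup>2 / \<alpha>"
      unfolding \<Delta>_def step using S closed x \<alpha> by (intro projected_step_inner_le)
    moreover have "(G (x t) - d t) \<bullet> \<Delta> t \<le> e t * (2 * D)"
    proof -
      have "(G (x t) - d t) \<bullet> \<Delta> t \<le> e t * norm (\<Delta> t)"
        unfolding e_def by (metis norm_cauchy_schwarz norm_minus_commute)
      also have "\<dots> \<le> e t * (2 * D)"
      proof (rule mult_left_mono)
        show "norm (\<Delta> t) \<le> 2 * D"
          unfolding \<Delta>_def using norm_triangle_ineq4[of "x (Suc t)" "x t"] D[OF x[of t]] D[OF x[of "Suc t"]]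
          by linarith
      qed (simp add: e_def)
      finally show ?thesis .
    qed
    moreover have "c * (norm (\<Delta> t))\<^sup>2 = (norm (\<Delta> t))\<^sup>2 / \<alpha> - L / 2 * (norm (\<Delta> t))\<^sup>2"
      by (simp add: c_def left_diff_distrib)
    ultimately show ?thesis
      by (simp add: mult.commute)
  qed
  have D0: "0 \<le> D"
    using D[OF z] norm_ge_zero order_trans by blast
  have "summable (\<lambda>t. c * (norm (\<Delta> t))\<^sup>2)"
  proof (rule bounded_imp_summable)
    show "0 \<le> c * (norm (\<Delta> t))\<^sup>2" for t
      using c by simp
    fix n
    have "(\<Sum>t\<le>n. c * (norm (\<Delta> t))\<^sup>2) \<le> (\<Sum>t\<le>n. f (x t) - f (x (Suc t)) + 2 * D * e t)"
      by (intro sum_mono descent)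
    also have "\<dots> = f (x 0) - f (x (Suc n)) + 2 * D * (\<Sum>t\<le>n. e t)"
      by (simp add: sum.distrib sum_distrib_left sum_telescope[of "\<lambda>t. f (x t)"])
    also have "\<dots> \<le> f (x 0) - m + 2 * D * (\<Sum>t. e t)"
      using m x D0 err
      by (intro add_mono diff_left_mono mult_left_mono sum_le_suminf) (auto simp: e_def)
    finally show "(\<Sum>t\<le>n. c * (norm (\<Delta> t))\<^sup>2) \<le> f (x 0) - m + 2 * D * (\<Sum>t. e t)" .
  qed
  then have "(\<lambda>t. (norm (\<Delta> t))\<^sup>2) \<longlonglongrightarrow> 0"
    using c by (auto dest: summable_LIMSEQ_zero)
  then have "(\<lambda>t. norm (\<Delta> t)) \<longlonglongrightarrow> 0"
    using tendsto_real_sqrt[of "\<lambda>t. (norm (\<Delta> t))\<^sup>2" 0] by simp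
  then have "\<Delta> \<longlonglongrightarrow> 0"
    by (rule tendsto_norm_zero_cancel)
  then have "(\<lambda>n. x (\<sigma> n) + \<Delta> (\<sigma> n)) \<longlonglongrightarrow> z + 0"
    using lim \<sigma> by (intro tendsto_add) (auto simp: o_def intro: LIMSEQ_subseq_LIMSEQ[unfolded o_def])
  then have next_lim: "(\<lambda>n. x (Suc (\<sigma> n))) \<longlonglongrightarrow> z"
    by (simp add: \<Delta>_def)
  have "(\<lambda>t. d t - G (x t)) \<longlonglongrightarrow> 0"
    using summable_LIMSEQ_zero[OF err] by (rule tendsto_norm_zero_cancel)
  then have "(\<lambda>n. d (\<sigma> n) - G (x (\<sigma> n))) \<longlonglongrightarrow> 0"
    using LIMSEQ_subseq_LIMSEQ[OF _ \<sigma>] by (auto simp: o_def)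
  moreover have "(\<lambda>n. G (x (\<sigma> n))) \<longlonglongrightarrow> G z"
    using lipschitz_on_continuous_on[OF lip] lim z x
    by (intro continuous_on_tendsto_compose[of S G]) (auto simp: o_def)
  ultimately have d_lim: "(\<lambda>n. d (\<sigma> n)) \<longlonglongrightarrow> G z"
    by (auto dest: tendsto_add)
  show "0 \<le> G z \<bullet> (w - z)" if "w \<in> S"
  proof -
    \<comment> \<open>The variational inequality characterizing the projection
      \<open>x (Suc (\<sigma> n))\<close>, tested at \<open>w\<close>; in the limit it becomes
      \<open>- \<alpha>\<close> times the desired inner product.\<close>
    let ?a = "\<lambda>n. (x (\<sigma> n) - \<alpha> *\<^sub>R d (\<sigma> n) - x (Suc (\<sigma> n))) \<bullet> (w - x (Suc (\<sigma> n)))"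
    have "?a \<longlonglongrightarrow> (z - \<alpha> *\<^sub>R G z - z) \<bullet> (w - z)"
      using lim by (intro tendsto_intros next_lim d_lim) (simp add: o_def)
    moreover have "?a n \<le> 0" for n
      unfolding step using S closed that by (intro closest_point_dot)
    ultimately have "(z - \<alpha> *\<^sub>R G z - z) \<bullet> (w - z) \<le> 0"
      by (intro LIMSEQ_le_const2) auto
    then show ?thesis
      using \<alpha> by (simp add: zero_le_mult_iff)
  qed
qed

section \<open>Relative derivatives and adjoints\<close>

text \<open>Within a thin set the derivative need not be unique as a linear map, but in the
  direction of a point of \<open>S\<close> it is the one-sided derivative along a segment. This
  handles the quantification over all gradients in \<open>stationary_point\<close>.\<close>

lemma has_derivative_within_convex_unique:
  fixes f :: "'a::real_normed_vector \<Rightarrow> 'b::real_normed_vector"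
  assumes "convex S" "z \<in> S" "w \<in> S"
    and f': "(f has_derivative f') (at z within S)" and f'': "(f has_derivative f'') (at z within S)"
  shows "f' (w - z) = f'' (w - z)"
proof -
  let ?h = "\<lambda>s::real. z + s *\<^sub>R (w - z)"
  have sub: "?h ` {0..1} \<subseteq> S"
    using convexD_alt[OF assms(1-3)] by (auto simp: algebra_simps)
  have "((\<lambda>s. f (?h s)) has_vector_derivative A (w - z)) (at 0 within {0..1})"
    if "(f has_derivative A) (at z within S)" for A
  proof -
    have "((f \<circ> ?h) has_derivative (A \<circ> (\<lambda>s. s *\<^sub>R (w - z)))) (at 0 within {0..1})"
    proof (rule diff_chain_within)
      show "(?h has_derivative (\<lambda>s. s *\<^sub>R (w - z))) (at 0 within {0..1})"
        by (auto intro!: derivative_eq_intros)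
      show "(f has_derivative A) (at (?h 0) within ?h ` {0..1})"
        using has_derivative_subset[OF that sub] by simp
    qed
    moreover have "linear A"
      using that by (rule has_derivative_linear)
    ultimately show ?thesis
      by (simp add: has_vector_derivative_def o_def linear_cmul)
  qed
  from this[OF f'] this[OF f''] show ?thesis
    by (intro vector_derivative_unique_within) (auto simp: trivial_limit_within islimpt_Icc)
qed

lemma adjoint_blinfun_inner:
  fixes A :: "'a::euclidean_space \<Rightarrow>\<^sub>L 'b::euclidean_space"
  shows "adjoint (blinfun_apply A) \<psi> \<bullet> v = \<psi> \<bullet> blinfun_apply A v"
  using adjoint_works[of "blinfun_apply A" v \<psi>]
    bounded_linear.linear[OF blinfun.bounded_linear_right, of A]
  by (simp add: inner_commute)

text \<open>The adjoint image is paired with itself and one factor of its norm is cancelled. Bounds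
  on Jacobians thereby become bounds on gradients.\<close>

lemma norm_adjoint_blinfun_le:
  fixes A :: "'a::euclidean_space \<Rightarrow>\<^sub>L 'b::euclidean_space"
  shows "norm (adjoint (blinfun_apply A) \<psi>) \<le> norm A * norm \<psi>"
proof -
  let ?a = "adjoint (blinfun_apply A) \<psi>"
  have "norm ?a * norm ?a = \<psi> \<bullet> blinfun_apply A ?a"
    by (metis adjoint_blinfun_inner norm_eq_sqrt_inner real_sqrt_mult_self abs_of_nonneg inner_ge_zero)
  also have "\<dots> \<le> norm \<psi> * (norm A * norm ?a)"
    by (intro order_trans[OF norm_cauchy_schwarz] mult_left_mono norm_blinfun) auto
  finally have "norm ?a * norm ?a \<le> (norm A * norm \<psi>) * norm ?a"
    by (simp add: ac_simps)
  then show ?thesis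
    by (cases "?a = 0") auto
qed

lemma adjoint_blinfun_diff:
  fixes A B :: "'a::euclidean_space \<Rightarrow>\<^sub>L 'b::euclidean_space"
  shows "adjoint (blinfun_apply (A - B)) \<psi> = adjoint (blinfun_apply A) \<psi> - adjoint (blinfun_apply B) \<psi>"
    and "adjoint (blinfun_apply A) (\<psi> - \<psi>') = adjoint (blinfun_apply A) \<psi> - adjoint (blinfun_apply A) \<psi>'"
proof -
  show "adjoint (blinfun_apply (A - B)) \<psi> = adjoint (blinfun_apply A) \<psi> - adjoint (blinfun_apply B) \<psi>"
    by (rule vector_eq_rdot[THEN iffD1])
      (simp add: adjoint_blinfun_inner inner_diff_left blinfun.diff_left inner_diff_right)
  show "adjoint (blinfun_apply A) (\<psi> - \<psi>') = adjoint (blinfun_apply A) \<psi> - adjoint (blinfun_apply A) \<psi>'"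
    by (rule vector_eq_rdot[THEN iffD1])
      (simp add: adjoint_blinfun_inner inner_diff_left)
qed

section \<open>Counting scores\<close>

lemma finite_in_nbrs: "E \<subseteq> {1..N} \<times> {1..N} \<Longrightarrow> finite (in_nbrs E i)"
  by (rule finite_subset[of _ "{1..N}"]) (auto simp: in_nbrs_def)

lemma sum_in_count:
  assumes "E \<subseteq> {1..N} \<times> {1..N}"
  shows "(\<Sum>i=1..N. in_count E i) = card E"
proof -
  have "E = (SIGMA i:{1..N}. in_nbrs E i)\<inverse>"
    using assms by (auto simp: in_nbrs_def)
  then have "card E = card (SIGMA i:{1..N}. in_nbrs E i)"
    by (metis card_inverse)
  also have "\<dots> = (\<Sum>i=1..N. in_count E i)"
    unfolding in_count_def using finite_in_nbrs[OF assms] by (intro card_SigmaI) auto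
  finally show ?thesis ..
qed

text \<open>The score classes are disjoint since \<open>r\<close> is injective, and they cover the
  in-neighborhood since every observed score lies in its range.\<close>

lemma sum_score_count:
  assumes "E \<subseteq> {1..N} \<times> {1..N}" and "inj r" and "\<forall>(i, j)\<in>E. y i j \<in> range r"
  shows "(\<Sum>h\<in>UNIV. score_count E y (r :: 'r::finite \<Rightarrow> 's) h i) = in_count E i"
proof -
  have "finite (in_nbrs E i)"
    using assms(1) by (rule finite_in_nbrs)
  moreover have "in_nbrs E i = (\<Union>h\<in>UNIV. {j \<in> in_nbrs E i. y j i = r h})"
    using assms(3) by (fastforce simp: in_nbrs_def)
  moreover have "card (\<Union>h\<in>UNIV. {j \<in> in_nbrs E i. y j i = r h})
      = (\<Sum>h\<in>UNIV. card {j \<in> in_nbrs E i. y j i = r h})"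
    using \<open>finite (in_nbrs E i)\<close> assms(2) by (intro card_UN_disjoint) (auto dest: injD)
  ultimately show ?thesis
    by (simp add: score_count_def in_count_def)
qed

text \<open>The frequencies are nonnegative with sum at most 1, which bounds the Euclidean norm
  through the l1 norm. Consequently the gradient of the objective inherits the constant
  \<open>L\<close> of the Jacobian.\<close>

lemma norm_score_freq_le_1:
  assumes "E \<subseteq> {1..N} \<times> {1..N}" and "inj r" and "\<forall>(i, j)\<in>E. y i j \<in> range r"
  shows "norm (score_freq N E y r) \<le> 1"
proof -
  have "norm (score_freq N E y r) \<le> (\<Sum>h\<in>UNIV. \<bar>score_freq N E y r $ h\<bar>)"
    by (rule norm_le_l1_cart)
  also have "\<dots> = (\<Sum>h\<in>UNIV. \<Sum>i=1..N. real (score_count E y r h i) / card E)"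
    by (simp add: score_freq_def sum_nonneg)
  also have "\<dots> = (\<Sum>i=1..N. \<Sum>h\<in>UNIV. real (score_count E y r h i) / card E)"
    by (rule sum.swap)
  also have "\<dots> = (\<Sum>i=1..N. real (in_count E i) / card E)"
    by (simp add: sum_score_count[OF assms, symmetric] sum_divide_distrib)
  also have "\<dots> = real (card E) / card E"
    unfolding sum_in_count[OF assms(1), symmetric] by (simp only: of_nat_sum sum_divide_distrib)
  \<comment> \<open>An inequality, because the quotient is 0 when \<open>E\<close> is empty.\<close>
  also have "\<dots> \<le> 1"
    by simp
  finally show ?thesis .
qed

section \<open>Consensus and descent combined\<close>

theorem mainTheorem4:
  fixes N C Q :: nat
    and ES :: "(nat \<times> nat) set"
    and r :: "'r::finite \<Rightarrow> 's"
    and y :: "nat \<Rightarrow> nat \<Rightarrow> 's"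
    and \<Theta> :: "'a::euclidean_space set"
    and \<Gamma> :: "'b::euclidean_space set"
    and p :: "'r \<Rightarrow> nat \<Rightarrow> nat \<Rightarrow> 'a \<Rightarrow> real"
    and q :: "nat \<Rightarrow> 'b \<Rightarrow> real"
    and Ecmm :: "nat \<Rightarrow> (nat \<times> nat) set"
    and S :: "('a \<times> 'b) set"
    and g :: "'a \<times> 'b \<Rightarrow> real^'r"
    and J :: "'a \<times> 'b \<Rightarrow> ('a \<times> 'b) \<Rightarrow>\<^sub>L (real^'r)"
    and L \<alpha> :: real
    and x :: "nat \<Rightarrow> nat \<Rightarrow> 'a \<times> 'b"
  defines "S \<equiv> feasible_theta C \<Theta> p \<times> feasible_gamma C \<Gamma> q"
    and "g \<equiv> neg_log_prob C p q"
  assumes score_graph: "ES \<subseteq> {1..N} \<times> {1..N}"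
    and score_in_edge: "\<forall>i\<in>{1..N}. \<exists>j. (j, i) \<in> ES"
    and scores_distinct: "inj r"
    and scores: "\<forall>(i, j)\<in>ES. y i j \<in> range r"
    and p_cont: "\<forall>h. \<forall>l\<in>{1..C}. \<forall>m\<in>{1..C}. continuous_on \<Theta> (p h l m)"
    and q_cont: "\<forall>l\<in>{1..C}. continuous_on \<Gamma> (q l)"
    and cmm_graph: "\<forall>t. Ecmm t \<subseteq> {1..N} \<times> {1..N}"
    and Q_pos: "Q \<ge> 1"
    and union_connected: "\<forall>t. strongly_connected (with_proj
          \<lparr> pverts = {1..N}, parcs = (\<Union>\<tau>\<in>{t * Q..(t + 1) * Q - 1}. Ecmm \<tau>) \<rparr>)"
    and feasible_compact: "compact S"
    and feasible_convex: "convex S"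
    and g_finite: "\<forall>z\<in>S. \<forall>h. score_prob C p q h z > 0"
    and g_deriv: "\<forall>z\<in>S. (g has_derivative blinfun_apply (J z)) (at z within \<Theta> \<times> \<Gamma>)"
    and J_bounded: "bounded (J ` S)"
    and L_pos: "L > 0"
    and J_lipschitz: "L-lipschitz_on S J"
    and step_size: "0 < \<alpha>" "\<alpha> < 2 / L"
    and x_init: "\<forall>i\<in>{1..N}. x 0 i \<in> S"
    and x_step: "\<forall>t. \<forall>i\<in>{1..N}.
          x (Suc t) i = proj_grad_step S \<alpha> J (local_freq ES y r Ecmm t i) (x t i)"
  shows "\<forall>i\<in>{1..N}. \<forall>z \<sigma>. strict_mono \<sigma> \<and> ((\<lambda>t. x t i) \<circ> \<sigma>) \<longlonglongrightarrow> z
           \<longrightarrow> stationary_point (\<Theta> \<times> \<Gamma>) (\<lambda>w. score_freq N ES y r \<bullet> g w) S z"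
proof -
  interpret net: connected_comm_network "{1..N}" Ecmm Q
  proof unfold_locales
    \<comment> \<open>Strong connectivity includes nonemptiness of the vertex set, so there is at
      least one agent.\<close>
    have "verts (with_proj \<lparr>pverts = {1..N}, parcs = (\<Union>\<tau>\<in>{0 * Q..(0 + 1) * Q - 1}. Ecmm \<tau>)\<rparr>) \<noteq> {}"
      using union_connected unfolding strongly_connected_def by blast
    then show "{1..N} \<noteq> {}"
      by simp
  next
    fix k X assume "X \<subseteq> {1..N}" "X \<noteq> {}" "X \<noteq> {1..N}"
    with union_connected[rule_format, of k] obtain i j
      where *: "(i, j) \<in> (\<Union>\<tau>\<in>{k * Q..(k + 1) * Q - 1}. Ecmm \<tau>)" "i \<in> X" "j \<in> {1..N} - X"
      by (rule strongly_connected_cut)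
    then obtain \<tau> where \<tau>: "\<tau> \<in> {k * Q..(k + 1) * Q - 1}" "(i, j) \<in> Ecmm \<tau>"
      by blast
    \<comment> \<open>Positivity makes the subtraction of 1 on naturals exact, so the closed
      interval is the half-open window.\<close>
    have "0 < (k + 1) * Q"
      using Q_pos by simp
    with \<tau> have "\<tau> \<in> {k * Q..<(k + 1) * Q}"
      by auto
    with * \<tau> show "\<exists>\<tau>\<in>{k * Q..<(k + 1) * Q}. \<exists>i\<in>X. \<exists>j\<in>{1..N} - X. (i, j) \<in> Ecmm \<tau>"
      by blast
  qed (use cmm_graph Q_pos in auto)
  define \<phi> where "\<phi> = score_freq N ES y r"
  define G where "G w = adjoint (blinfun_apply (J w)) \<phi>" for w
  let ?f = "\<lambda>w. \<phi> \<bullet> g w"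
  have S_sub: "S \<subseteq> \<Theta> \<times> \<Gamma>"
    by (auto simp: S_def feasible_theta_def feasible_gamma_def)
  have f_deriv: "(?f has_derivative (\<lambda>v. G w \<bullet> v)) (at w within \<Theta> \<times> \<Gamma>)" if "w \<in> S" for w
    using has_derivative_inner_right[OF g_deriv[rule_format, OF that], of \<phi>]
    by (simp add: G_def adjoint_blinfun_inner)
  have G_lip: "L-lipschitz_on S G"
  proof (rule lipschitz_onI)
    fix u v assume uv: "u \<in> S" "v \<in> S"
    have "dist (G u) (G v) = norm (adjoint (blinfun_apply (J u - J v)) \<phi>)"
      by (simp add: G_def dist_norm adjoint_blinfun_diff)
    also have "\<dots> \<le> norm (J u - J v) * norm \<phi>"
      by (rule norm_adjoint_blinfun_le)
    also have "\<dots> \<le> norm (J u - J v)"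
      using norm_score_freq_le_1[OF score_graph scores_distinct scores]
      by (simp add: \<phi>_def mult_left_le)
    also have "\<dots> \<le> L * dist u v"
      using lipschitz_onD[OF J_lipschitz uv] by (simp add: dist_norm)
    finally show "dist (G u) (G v) \<le> L * dist u v" .
  qed (use L_pos in simp)
  obtain B where B: "norm (J w) \<le> B" if "w \<in> S" for w
    using J_bounded by (auto simp: bounded_iff)
  show ?thesis
  proof (intro ballI allI impI)
    fix i z \<sigma>
    assume i: "i \<in> {1..N}" and "strict_mono \<sigma> \<and> ((\<lambda>t. x t i) \<circ> \<sigma>) \<longlonglongrightarrow> z"
    then have \<sigma>: "strict_mono \<sigma>" and lim: "((\<lambda>t. x t i) \<circ> \<sigma>) \<longlonglongrightarrow> z"
      by auto
    let ?\<psi> = "\<lambda>t. local_freq ES y r Ecmm t i"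
    define d where "d t = adjoint (blinfun_apply (J (x t i))) (?\<psi> t)" for t
    have step: "x (Suc t) i = closest_point S (x t i - \<alpha> *\<^sub>R d t)" for t
      using x_step i by (simp add: proj_grad_step_def d_def)
    have xS: "x t i \<in> S" for t
      using x_init i compact_imp_closed[OF feasible_compact]
      by (cases t) (auto simp: step intro!: closest_point_in_set)
    \<comment> \<open>Every agent has been evaluated at least once, so all initial denominators are
      positive.\<close>
    have in_pos: "0 < real (in_count ES j)" if "j \<in> {1..N}" for j
      using score_in_edge that finite_in_nbrs[OF score_graph, of j]
      by (auto simp: in_count_def in_nbrs_def card_gt_0_iff)
    \<comment> \<open>The initial denominators add up to \<open>card ES\<close>, so the consensus
      limit is exactly the component \<open>h\<close> of \<open>\<phi>\<close>.\<close>
    have "summable (\<lambda>t. \<bar>?\<psi> t $ h - \<phi> $ h\<bar>)" for h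
      using net.push_sum_ratio_summable[of "\<lambda>j. real (in_count ES j)" i
          "\<lambda>j. real (score_count ES y r h j)", OF in_pos i]
      unfolding of_nat_sum[symmetric] sum_in_count[OF score_graph]
      by (simp add: local_freq_def \<phi>_def score_freq_def sum_divide_distrib)
    then have dominating: "summable (\<lambda>t. B * (\<Sum>h\<in>UNIV. \<bar>?\<psi> t $ h - \<phi> $ h\<bar>))"
      by (intro summable_mult summable_sum)
    have dominated: "norm (d t - G (x t i)) \<le> B * (\<Sum>h\<in>UNIV. \<bar>?\<psi> t $ h - \<phi> $ h\<bar>)" for t
    proof -
      have "norm (d t - G (x t i)) \<le> norm (J (x t i)) * norm (?\<psi> t - \<phi>)"
        unfolding d_def G_def adjoint_blinfun_diff(2)[symmetric] by (rule norm_adjoint_blinfun_le)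
      also have "\<dots> \<le> B * (\<Sum>h\<in>UNIV. \<bar>?\<psi> t $ h - \<phi> $ h\<bar>)"
        using B[OF xS] norm_le_l1_cart[of "?\<psi> t - \<phi>"] order_trans[OF norm_ge_zero B[OF xS]]
        by (intro mult_mono) auto
      finally show ?thesis .
    qed
    have err: "summable (\<lambda>t. norm (d t - G (x t i)))"
      by (rule summable_comparison_test'[OF dominating, where N = 0]) (use dominated in simp)
    have f_deriv_S: "(?f has_derivative (\<lambda>v. G w \<bullet> v)) (at w within S)" if "w \<in> S" for w
      using f_deriv[OF that] S_sub by (rule has_derivative_subset)
    note convergence = perturbed_projected_gradient_limit[OF feasible_compact feasible_convex _
        G_lip L_pos step_size x_init[rule_format, OF i] step err \<sigma> lim, where f = ?f]
    have limit: "z \<in> S" "\<And>w. w \<in> S \<Longrightarrow> 0 \<le> G z \<bullet> (w - z)"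
      by (rule convergence(1), erule f_deriv_S) (rule convergence(2), erule f_deriv_S)
    \<comment> \<open>Any gradient \<open>v\<close> relative to the larger domain is also one
      relative to \<open>S\<close>, hence agrees with \<open>G z\<close> in directions towards
      points of \<open>S\<close>.\<close>
    have "0 \<le> v \<bullet> (w - z)"
      if v: "(?f has_derivative (\<lambda>d. v \<bullet> d)) (at z within \<Theta> \<times> \<Gamma>)" and w: "w \<in> S" for v w
      using has_derivative_within_convex_unique[OF feasible_convex limit(1) w
          has_derivative_subset[OF v S_sub] f_deriv_S[OF limit(1)]] limit(2)[OF w]
      by simp
    then show "stationary_point (\<Theta> \<times> \<Gamma>) (\<lambda>w. score_freq N ES y r \<bullet> g w) S z"
      using limit(1) differentiableI[OF f_deriv[OF limit(1)]]
      unfolding stationary_point_def \<phi>_def by blast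
  qed
qed

end
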